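(* Let $\mathbf{G}$ be a coherent canonical system for a propositional language $\mathcal{L}$. Then: (1) for every set $\mathcal{S}$ of sequents and every sequent $s$: $\mathcal{S}\vdash^{seq}_{\mathbf G} s$ if and only if $\mathcal{S}\vDash^{seq}_{\mathbf G} s$; (2) for every set $\mathcal{T}$ of formulas and every set $E$ of formulas with at most one element: $\mathcal{T}\vdash_{\mathbf G} E$ if and only if $\mathcal{T}\vDash_{\mathbf G} E$.
   Context: Syntax. $\mathcal{L}$ is a propositional language with atoms $p_1,p_2,\ldots$ and set of formulas $\mathcal{F}$. A sequent is an expression $\Gamma\Rightarrow E$ where $\Gamma$ is a finite set of formulas and $E$ is a set of formulas with at most one element (written $\Gamma\Rightarrow$ if $E=\emptyset$ and $\Gamma\Rightarrow\varphi$ if $E=\{\varphi\}$). A clause is a sequent containing only atoms. An $\mathcal{L}$-substitution is a map $\sigma:\mathcal{F}\to\mathcal{F}$ with $\sigma(\diamond(\psi_1,\dots,\psi_n))=\diamond(\sigma(\psi_1),\dots,\sigma(\psi_n))$ for every connective $\diamond$, extended to sets pointwise ($\sigma(\emptyset)=\emptyset$). A canonical right-introduction rule for an $n$-ary connective $\diamond$ is an expression $\{\Pi_i\Rightarrow E_i\}_{1\le i\le m}/\ \Rightarrow\diamond(p_1,\dots,p_n)$ with $m\ge 0$ and $\Pi_i\cup E_i\subseteq\{p_1,\dots,p_n\}$ (premises are clauses); an application infers $\Gamma\Rightarrow\sigma(\diamond(p_1,\dots,p_n))$ from the sequents $\Gamma,\sigma(\Pi_i)\Rightarrow\sigma(E_i)$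 ($1\le i\le m$), for any finite $\Gamma$ and substitution $\sigma$. A canonical left-introduction rule for $\diamond$ is an expression $\langle\{\Pi_i\Rightarrow E_i\}_{1\le i\le m},\{\Sigma_j\Rightarrow\}_{1\le j\le k}\rangle/\ \diamond(p_1,\dots,p_n)\Rightarrow$ with $m,k\ge0$, $\Pi_i\cup E_i\subseteq\{p_1,\dots,p_n\}$, $\Sigma_j\subseteq\{p_1,\dots,p_n\}$; the $\Pi_i\Rightarrow E_i$ are its hard premises and the $\Sigma_j\Rightarrow$ its soft premises; an application infers $\Gamma,\sigma(\diamond(p_1,\dots,p_n))\Rightarrow E$ from $\Gamma,\sigma(\Pi_i)\Rightarrow\sigma(E_i)$ ($1\le i\le m$) and $\Gamma,\sigma(\Sigma_j)\Rightarrow E$ ($1\le j\le k$), for any sequent $\Gamma\Rightarrow E$ and substitution $\sigma$. A canonical system is a sequent calculus whose axioms are all $\varphi\Rightarrow\varphi$, whose rules are weakening (from $\Gamma\Rightarrow E$ infer $\Gamma,\Delta\Rightarrow E$; from $\Gamma\Rightarrow$ infer $\Gamma\Rightarrow\psi$), cut (from $\Gamma\Rightarrow\varphi$ and $\Delta,\varphi\Rightarrow E$ infer $\Gamma,\Delta\Rightarrow E$), and a set of canonical right- and left-introduction rules. $\mathcal{S}\vdash^{seq}_{\mathbf G}s$ means $s$ has a derivation in $\mathbf G$ from the set of sequents $\mathcal{S}$ used as extra axioms. $\mathcal{T}\vdash_{\mathbf G}E$ means $\vdash^{seq}_{\mathbf G}\Gamma\Rightarrow E$ for some finite $\Gamma\subseteq\mathcal{T}$.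 Coherence. A classical assignment $u$ (atoms to $\{t,f\}$) satisfies a clause $\Pi\Rightarrow E$ iff $u(p)=f$ for some $p\in\Pi$ or $E=\{q\}$ with $u(q)=t$; a set of clauses is classically inconsistent iff no assignment satisfies all of them. $\mathbf G$ is coherent iff for every connective $\diamond$, whenever $\mathbf G$ contains a left rule $\langle S_1,S_2\rangle/\diamond(p_1,\dots,p_n)\Rightarrow$ and a right rule $S_3/\Rightarrow\diamond(p_1,\dots,p_n)$, the set $S_1\cup S_2\cup S_3$ is classically inconsistent. Semantics. For a set $\mathcal{U}$ of formulas closed under subformulas, a $\mathcal{U}$-semiframe is $\langle W,\le,v\rangle$ with $(W,\le)$ a nonempty partial order and $v:W\times\mathcal{U}\to\{t,f\}$ persistent ($v(a,\varphi)=t$ and $a\le b$ imply $v(b,\varphi)=t$); an $\mathcal{L}$-frame is an $\mathcal{F}$-semiframe. A sequent $\Gamma\Rightarrow E$ is locally true at $a$ iff $\Gamma\cup E\subseteq\mathcal{U}$ and either $v(a,\psi)=f$ for some $\psi\in\Gamma$ or $E=\{\varphi\}$ with $v(a,\varphi)=t$; it is true at $a$ iff locally true at every $b\ge a$. A semiframe is a model of a sequent iff it is true at every $a\in W$, and of a set of sequents iff of each member; it is a model of a formula $\varphi$ iff $v(a,\varphi)=t$ for all $a$, of a set of formulas $\mathcal{T}$ iff of each member, and of $E$ (at most one element) iff it is a model of the sequent $\emptyset\Rightarrow E$ (so no frame is a model of $E=\emptyset$). A substitution $\sigma$ (locally) satisfies a clause $\Gamma\Rightarrow E$ at $a$ iff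 $\sigma(\Gamma)\Rightarrow\sigma(E)$ is (locally) true at $a$. $\sigma$ fulfils a right rule at $a$ iff it satisfies all its premises at $a$; it fulfils a left rule at $a$ iff it satisfies every hard premise at $a$ and locally satisfies every soft premise at $a$. A semiframe respects a rule $r$ for $\diamond$ iff for all $a\in W$ and substitutions $\sigma$: if $\sigma$ fulfils $r$ at $a$ and $\sigma(\diamond(p_1,\dots,p_n))\in\mathcal{U}$, then $\sigma$ locally satisfies the conclusion of $r$ at $a$. It is $\mathbf G$-legal iff it respects all canonical rules of $\mathbf G$. $\mathcal{S}\vDash^{seq}_{\mathbf G}s$ iff every $\mathbf G$-legal $\mathcal{L}$-frame that is a model of $\mathcal S$ is a model of $s$; $\mathcal{T}\vDash_{\mathbf G}E$ iff every $\mathbf G$-legal $\mathcal{L}$-frame that is a model of $\mathcal T$ is a model of $E$. *)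

theory Defs
  imports Main
begin

text \<open>A language assigns an arity to each of its connectives; symbols outside the domain of the
  map are not connectives of the language. \<open>Atom i\<close> is the atom $p_{i+1}$.\<close>

type_synonym 'c lang = "'c \<rightharpoonup> nat"

datatype 'c fm = Atom nat | Conn 'c "'c fm list"

inductive_set formulas :: "'c lang \<Rightarrow> 'c fm set" for L where
  atom: "Atom i \<in> formulas L"
| conn: "L c = Some (length \<psi>s) \<Longrightarrow> (\<And>\<psi>. \<psi> \<in> set \<psi>s \<Longrightarrow> \<psi> \<in> formulas L) \<Longrightarrow>
    Conn c \<psi>s \<in> formulas L"

definition is_subst :: "'c lang \<Rightarrow> ('c fm \<Rightarrow> 'c fm) \<Rightarrow> bool" where
  "is_subst L \<sigma> \<longleftrightarrow> \<sigma> ` formulas L \<subseteq> formulas L \<and>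
    (\<forall>c \<psi>s. Conn c \<psi>s \<in> formulas L \<longrightarrow> \<sigma> (Conn c \<psi>s) = Conn c (map \<sigma> \<psi>s))"

text \<open>The pair \<open>(\<Gamma>, E)\<close> is the sequent $\Gamma \Rightarrow E$.\<close>

type_synonym 'c sequent = "'c fm set \<times> 'c fm set"

definition at_most_one :: "'a set \<Rightarrow> bool" where
  "at_most_one E \<longleftrightarrow> (\<forall>x\<in>E. \<forall>y\<in>E. x = y)"

definition is_sequent :: "'c lang \<Rightarrow> 'c sequent \<Rightarrow> bool" where
  "is_sequent L = (\<lambda>(\<Gamma>, E). finite \<Gamma> \<and> \<Gamma> \<subseteq> formulas L \<and> E \<subseteq> formulas L \<and> at_most_one E)"

definition is_clause :: "'c lang \<Rightarrow> 'c sequent \<Rightarrow> bool" where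
  "is_clause L = (\<lambda>(\<Gamma>, E). is_sequent L (\<Gamma>, E) \<and> \<Gamma> \<union> E \<subseteq> range Atom)"

text \<open>The formula $\diamond(p_1,\dots,p_n)$ and the set $\{p_1,\dots,p_n\}$, for $\diamond$ of
  arity $n$ in \<open>L\<close>.\<close>

definition principal :: "'c lang \<Rightarrow> 'c \<Rightarrow> 'c fm" where
  "principal L c = Conn c (map Atom [0..<the (L c)])"

definition atoms_of_conn :: "'c lang \<Rightarrow> 'c \<Rightarrow> 'c fm set" where
  "atoms_of_conn L c = Atom ` {0..<the (L c)}"

text \<open>\<open>RightRule c P\<close> has premises \<open>P\<close>; \<open>LeftRule c H S\<close> has hard premises \<open>H\<close> and soft
  premises \<open>S\<close>. The conclusions are determined by \<open>c\<close>.\<close>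

datatype 'c rule =
    RightRule 'c "'c sequent set"
  | LeftRule 'c "'c sequent set" "'c sequent set"

definition premises_for :: "'c lang \<Rightarrow> 'c \<Rightarrow> 'c sequent set \<Rightarrow> bool" where
  "premises_for L c P \<longleftrightarrow> finite P \<and>
    (\<forall>(\<Pi>, E)\<in>P. is_clause L (\<Pi>, E) \<and> \<Pi> \<union> E \<subseteq> atoms_of_conn L c)"

fun canonical_rule :: "'c lang \<Rightarrow> 'c rule \<Rightarrow> bool" where
  "canonical_rule L (RightRule c P) \<longleftrightarrow> c \<in> dom L \<and> premises_for L c P"
| "canonical_rule L (LeftRule c H S) \<longleftrightarrow>
    c \<in> dom L \<and> premises_for L c H \<and> premises_for L c S \<and> (\<forall>(\<Sigma>, E)\<in>S. E = {})"

text \<open>Axioms, weakening and cut are common to all canonical systems, so a system is given by its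
  set of canonical rules, which may be infinite.\<close>

definition canonical_system :: "'c lang \<Rightarrow> 'c rule set \<Rightarrow> bool" where
  "canonical_system L G \<longleftrightarrow> (\<forall>r\<in>G. canonical_rule L r)"

inductive derives :: "'c lang \<Rightarrow> 'c rule set \<Rightarrow> 'c sequent set \<Rightarrow> 'c sequent \<Rightarrow> bool"
  for L G \<S> where
  assumption: "s \<in> \<S> \<Longrightarrow> derives L G \<S> s"
| identity: "\<phi> \<in> formulas L \<Longrightarrow> derives L G \<S> ({\<phi>}, {\<phi>})"
| weaken_left: "derives L G \<S> (\<Gamma>, E) \<Longrightarrow> finite \<Delta> \<Longrightarrow> \<Delta> \<subseteq> formulas L \<Longrightarrow>
    derives L G \<S> (\<Gamma> \<union> \<Delta>, E)"
| weaken_right: "derives L G \<S> (\<Gamma>, {}) \<Longrightarrow> \<psi> \<in> formulas L \<Longrightarrow> derives L G \<S> (\<Gamma>, {\<psi>})"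
| cut: "derives L G \<S> (\<Gamma>, {\<phi>}) \<Longrightarrow> derives L G \<S> (\<Delta> \<union> {\<phi>}, E) \<Longrightarrow>
    derives L G \<S> (\<Gamma> \<union> \<Delta>, E)"
| right_rule: "RightRule c P \<in> G \<Longrightarrow> is_subst L \<sigma> \<Longrightarrow> finite \<Gamma> \<Longrightarrow> \<Gamma> \<subseteq> formulas L \<Longrightarrow>
    (\<And>\<Pi> E. (\<Pi>, E) \<in> P \<Longrightarrow> derives L G \<S> (\<Gamma> \<union> \<sigma> ` \<Pi>, \<sigma> ` E)) \<Longrightarrow>
    derives L G \<S> (\<Gamma>, {\<sigma> (principal L c)})"
| left_rule: "LeftRule c H S \<in> G \<Longrightarrow> is_subst L \<sigma> \<Longrightarrow> is_sequent L (\<Gamma>, E) \<Longrightarrow>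
    (\<And>\<Pi> F. (\<Pi>, F) \<in> H \<Longrightarrow> derives L G \<S> (\<Gamma> \<union> \<sigma> ` \<Pi>, \<sigma> ` F)) \<Longrightarrow>
    (\<And>\<Sigma> F. (\<Sigma>, F) \<in> S \<Longrightarrow> derives L G \<S> (\<Gamma> \<union> \<sigma> ` \<Sigma>, E)) \<Longrightarrow>
    derives L G \<S> (\<Gamma> \<union> {\<sigma> (principal L c)}, E)"

definition derives_fm :: "'c lang \<Rightarrow> 'c rule set \<Rightarrow> 'c fm set \<Rightarrow> 'c fm set \<Rightarrow> bool" where
  "derives_fm L G \<T> E \<longleftrightarrow> (\<exists>\<Gamma>. finite \<Gamma> \<and> \<Gamma> \<subseteq> \<T> \<and> derives L G {} (\<Gamma>, E))"

definition classically_satisfies :: "(nat \<Rightarrow> bool) \<Rightarrow> 'c sequent \<Rightarrow> bool" where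
  "classically_satisfies u = (\<lambda>(\<Pi>, E).
    (\<exists>i. Atom i \<in> \<Pi> \<and> \<not> u i) \<or> (\<exists>i. E = {Atom i} \<and> u i))"

definition classically_inconsistent :: "'c sequent set \<Rightarrow> bool" where
  "classically_inconsistent C \<longleftrightarrow> \<not> (\<exists>u. \<forall>s\<in>C. classically_satisfies u s)"

definition coherent :: "'c rule set \<Rightarrow> bool" where
  "coherent G \<longleftrightarrow> (\<forall>c S1 S2 S3. LeftRule c S1 S2 \<in> G \<and> RightRule c S3 \<in> G \<longrightarrow>
    classically_inconsistent (S1 \<union> S2 \<union> S3))"

text \<open>Only the values of \<open>val\<close> on \<open>worlds \<times> U\<close> are relevant for a \<open>U\<close>-semiframe.\<close>

record ('c, 'w) semiframe =
  worlds :: "'w set"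
  le :: "('w \<times> 'w) set"
  val :: "'w \<Rightarrow> 'c fm \<Rightarrow> bool"

definition subformula_closed :: "'c fm set \<Rightarrow> bool" where
  "subformula_closed U \<longleftrightarrow> (\<forall>c \<psi>s. Conn c \<psi>s \<in> U \<longrightarrow> set \<psi>s \<subseteq> U)"

definition is_semiframe :: "'c lang \<Rightarrow> 'c fm set \<Rightarrow> ('c, 'w) semiframe \<Rightarrow> bool" where
  "is_semiframe L U M \<longleftrightarrow> U \<subseteq> formulas L \<and> subformula_closed U \<and>
    worlds M \<noteq> {} \<and> partial_order_on (worlds M) (le M) \<and>
    (\<forall>a b. \<forall>\<phi>\<in>U. (a, b) \<in> le M \<and> val M a \<phi> \<longrightarrow> val M b \<phi>)"

abbreviation is_frame :: "'c lang \<Rightarrow> ('c, 'w) semiframe \<Rightarrow> bool" where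
  "is_frame L \<equiv> is_semiframe L (formulas L)"

definition locally_true :: "'c fm set \<Rightarrow> ('c, 'w) semiframe \<Rightarrow> 'w \<Rightarrow> 'c sequent \<Rightarrow> bool" where
  "locally_true U M a = (\<lambda>(\<Gamma>, E). \<Gamma> \<union> E \<subseteq> U \<and>
    ((\<exists>\<psi>\<in>\<Gamma>. \<not> val M a \<psi>) \<or> (\<exists>\<phi>. E = {\<phi>} \<and> val M a \<phi>)))"

definition true_at :: "'c fm set \<Rightarrow> ('c, 'w) semiframe \<Rightarrow> 'w \<Rightarrow> 'c sequent \<Rightarrow> bool" where
  "true_at U M a s \<longleftrightarrow> (\<forall>b. (a, b) \<in> le M \<longrightarrow> locally_true U M b s)"

definition model_sequent :: "'c fm set \<Rightarrow> ('c, 'w) semiframe \<Rightarrow> 'c sequent \<Rightarrow> bool" where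
  "model_sequent U M s \<longleftrightarrow> (\<forall>a\<in>worlds M. true_at U M a s)"

definition model_fm :: "('c, 'w) semiframe \<Rightarrow> 'c fm \<Rightarrow> bool" where
  "model_fm M \<phi> \<longleftrightarrow> (\<forall>a\<in>worlds M. val M a \<phi>)"

definition subst_sequent :: "('c fm \<Rightarrow> 'c fm) \<Rightarrow> 'c sequent \<Rightarrow> 'c sequent" where
  "subst_sequent \<sigma> = (\<lambda>(\<Gamma>, E). (\<sigma> ` \<Gamma>, \<sigma> ` E))"

definition locally_satisfies ::
    "'c fm set \<Rightarrow> ('c, 'w) semiframe \<Rightarrow> ('c fm \<Rightarrow> 'c fm) \<Rightarrow> 'w \<Rightarrow> 'c sequent \<Rightarrow> bool" where
  "locally_satisfies U M \<sigma> a s \<longleftrightarrow> locally_true U M a (subst_sequent \<sigma> s)"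

definition satisfies ::
    "'c fm set \<Rightarrow> ('c, 'w) semiframe \<Rightarrow> ('c fm \<Rightarrow> 'c fm) \<Rightarrow> 'w \<Rightarrow> 'c sequent \<Rightarrow> bool" where
  "satisfies U M \<sigma> a s \<longleftrightarrow> true_at U M a (subst_sequent \<sigma> s)"

fun fulfils ::
    "'c fm set \<Rightarrow> ('c, 'w) semiframe \<Rightarrow> ('c fm \<Rightarrow> 'c fm) \<Rightarrow> 'w \<Rightarrow> 'c rule \<Rightarrow> bool" where
  "fulfils U M \<sigma> a (RightRule c P) \<longleftrightarrow> (\<forall>s\<in>P. satisfies U M \<sigma> a s)"
| "fulfils U M \<sigma> a (LeftRule c H S) \<longleftrightarrow>
    (\<forall>s\<in>H. satisfies U M \<sigma> a s) \<and> (\<forall>s\<in>S. locally_satisfies U M \<sigma> a s)"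

fun rule_conn :: "'c rule \<Rightarrow> 'c" where
  "rule_conn (RightRule c P) = c"
| "rule_conn (LeftRule c H S) = c"

fun conclusion :: "'c lang \<Rightarrow> 'c rule \<Rightarrow> 'c sequent" where
  "conclusion L (RightRule c P) = ({}, {principal L c})"
| "conclusion L (LeftRule c H S) = ({principal L c}, {})"

definition respects_rule :: "'c lang \<Rightarrow> 'c fm set \<Rightarrow> ('c, 'w) semiframe \<Rightarrow> 'c rule \<Rightarrow> bool" where
  "respects_rule L U M r \<longleftrightarrow> (\<forall>a\<in>worlds M. \<forall>\<sigma>. is_subst L \<sigma> \<longrightarrow>
    fulfils U M \<sigma> a r \<and> \<sigma> (principal L (rule_conn r)) \<in> U \<longrightarrow>
    locally_satisfies U M \<sigma> a (conclusion L r))"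

definition legal :: "'c lang \<Rightarrow> 'c fm set \<Rightarrow> 'c rule set \<Rightarrow> ('c, 'w) semiframe \<Rightarrow> bool" where
  "legal L U G M \<longleftrightarrow> (\<forall>r\<in>G. respects_rule L U M r)"

text \<open>HOL cannot quantify over the type of worlds inside a formula, so the consequence relations
  take that type as an argument. The relation over all frames is the conjunction of these
  relations over all types \<open>'w\<close>.\<close>

definition entails_sequent ::
    "'w itself \<Rightarrow> 'c lang \<Rightarrow> 'c rule set \<Rightarrow> 'c sequent set \<Rightarrow> 'c sequent \<Rightarrow> bool" where
  "entails_sequent _ L G \<S> s \<longleftrightarrow> (\<forall>M :: ('c, 'w) semiframe.
    is_frame L M \<and> legal L (formulas L) G M \<and> (\<forall>t\<in>\<S>. model_sequent (formulas L) M t) \<longrightarrow>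
    model_sequent (formulas L) M s)"

definition entails_fm ::
    "'w itself \<Rightarrow> 'c lang \<Rightarrow> 'c rule set \<Rightarrow> 'c fm set \<Rightarrow> 'c fm set \<Rightarrow> bool" where
  "entails_fm _ L G \<T> E \<longleftrightarrow> (\<forall>M :: ('c, 'w) semiframe.
    is_frame L M \<and> legal L (formulas L) G M \<and> (\<forall>\<phi>\<in>\<T>. model_fm M \<phi>) \<longrightarrow>
    model_sequent (formulas L) M ({}, E))"

end

theory Submission
  imports Defs
begin

text \<open>Soundness is an induction on derivations. For completeness, the worlds of the canonical frame
  are the sets of formulas that are maximal among those not deriving some fixed right-hand side, the
  order is inclusion, and a formula is true in the worlds that contain it. Hard premises and
  premises of right rules quantify over all larger worlds, so their validity is derivability
  from the world. Soft premises are only evaluated locally, and there maximality turns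
  \<open>\<phi> \<notin> T\<close> into derivability of the right-hand side of \<open>T\<close> from \<open>T \<union> {\<phi>}\<close>,
  which is exactly what the left rule consumes.\<close>

section \<open>Formulas, substitutions and premises of rules\<close>

lemma principal_in_formulas:
  assumes "c \<in> dom L"
  shows "principal L c \<in> formulas L"
proof -
  have "L c = Some (length (map Atom [0..<the (L c)] :: 'a fm list))"
    using assms by auto
  then show ?thesis
    unfolding principal_def by (rule formulas.conn) (auto intro: formulas.atom)
qed

lemma is_subst_formulas: "is_subst L \<sigma> \<Longrightarrow> \<phi> \<in> formulas L \<Longrightarrow> \<sigma> \<phi> \<in> formulas L"
  unfolding is_subst_def by blast

lemma is_subst_principal:
  "is_subst L \<sigma> \<Longrightarrow> c \<in> dom L \<Longrightarrow> \<sigma> (principal L c) \<in> formulas L"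
  by (rule is_subst_formulas[OF _ principal_in_formulas])

lemma premises_for_subst:
  assumes "premises_for L c P" and "(\<Pi>, E) \<in> P" and "is_subst L \<sigma>"
  shows "finite (\<sigma> ` \<Pi>)" "\<sigma> ` \<Pi> \<subseteq> formulas L" "\<sigma> ` E \<subseteq> formulas L" "at_most_one (\<sigma> ` E)"
proof -
  have "is_sequent L (\<Pi>, E)"
    using assms(1,2) unfolding premises_for_def is_clause_def by blast
  then have seq: "finite \<Pi>" "\<Pi> \<subseteq> formulas L" "E \<subseteq> formulas L" "at_most_one E"
    by (simp_all add: is_sequent_def)
  show "finite (\<sigma> ` \<Pi>)" using seq(1) by (rule finite_imageI)
  show "\<sigma> ` \<Pi> \<subseteq> formulas L" "\<sigma> ` E \<subseteq> formulas L"
    using seq(2,3) is_subst_formulas[OF assms(3)] by (auto simp: subset_iff)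
  show "at_most_one (\<sigma> ` E)" using seq(4) by (auto simp: at_most_one_def)
qed

lemma at_most_one_cases:
  assumes "at_most_one E"
  obtains "E = {}" | \<phi> where "E = {\<phi>}"
  using assms unfolding at_most_one_def by blast

section \<open>Truth in semiframes and soundness\<close>

lemma locally_true_iff:
  "locally_true U M a (\<Gamma>, E) \<longleftrightarrow> \<Gamma> \<union> E \<subseteq> U \<and>
    ((\<forall>\<psi>\<in>\<Gamma>. val M a \<psi>) \<longrightarrow> (\<exists>\<phi>. E = {\<phi>} \<and> val M a \<phi>))"
  unfolding locally_true_def by auto

lemma is_semiframe_order:
  assumes "is_semiframe L U M"
  shows "a \<in> worlds M \<Longrightarrow> (a, a) \<in> le M" "(a, b) \<in> le M \<Longrightarrow> b \<in> worlds M"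
    "(a, b) \<in> le M \<Longrightarrow> \<phi> \<in> U \<Longrightarrow> val M a \<phi> \<Longrightarrow> val M b \<phi>"
proof -
  have "partial_order_on (worlds M) (le M)" using assms unfolding is_semiframe_def by blast
  then show "a \<in> worlds M \<Longrightarrow> (a, a) \<in> le M" "(a, b) \<in> le M \<Longrightarrow> b \<in> worlds M"
    unfolding partial_order_on_def preorder_on_def refl_on_def by blast+
  show "(a, b) \<in> le M \<Longrightarrow> \<phi> \<in> U \<Longrightarrow> val M a \<phi> \<Longrightarrow> val M b \<phi>"
    using assms unfolding is_semiframe_def by blast
qed

text \<open>Reflexivity gives local truth at the world itself, and larger worlds are again in
  \<open>worlds M\<close>, so quantifying over all worlds absorbs the upward quantifier of
  \<open>true_at\<close>.\<close>

lemma model_sequent_iff_locally_true: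
  assumes "is_semiframe L U M"
  shows "model_sequent U M s \<longleftrightarrow> (\<forall>a\<in>worlds M. locally_true U M a s)"
  using is_semiframe_order[OF assms] unfolding model_sequent_def true_at_def by blast

text \<open>Persistence carries a context that is true at \<open>a\<close> to every \<open>b \<ge> a\<close>, so a premise that is
  locally true everywhere with the context is true at \<open>a\<close> without it.\<close>

lemma satisfies_of_context:
  assumes frame: "is_semiframe L U M" and \<Gamma>: "\<Gamma> \<subseteq> U" "\<forall>\<psi>\<in>\<Gamma>. val M a \<psi>"
    and loc: "\<forall>b\<in>worlds M. locally_true U M b (\<Gamma> \<union> \<sigma> ` \<Pi>, \<sigma> ` E)"
  shows "satisfies U M \<sigma> a (\<Pi>, E)"
  unfolding satisfies_def true_at_def
proof (intro allI impI)
  fix b assume ab: "(a, b) \<in> le M"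
  then have "\<forall>\<psi>\<in>\<Gamma>. val M b \<psi>" and "b \<in> worlds M"
    using \<Gamma> is_semiframe_order[OF frame] by blast+
  then show "locally_true U M b (subst_sequent \<sigma> (\<Pi>, E))"
    using loc unfolding subst_sequent_def by (fastforce simp: locally_true_iff)
qed

lemma legal_rule:
  assumes "legal L U G M" "r \<in> G" "a \<in> worlds M" "is_subst L \<sigma>" "fulfils U M \<sigma> a r"
    "\<sigma> (principal L (rule_conn r)) \<in> U"
  shows "locally_satisfies U M \<sigma> a (conclusion L r)"
  using assms unfolding legal_def respects_rule_def by blast

text \<open>The induction carries local truth at all worlds instead of a fixed one, since hard
  premises and premises of right rules have to hold at every larger world.\<close>

lemma soundness:
  assumes sys: "canonical_system L G" and frame: "is_frame L M"
    and leg: "legal L (formulas L) G M" and S: "\<forall>t\<in>\<S>. model_sequent (formulas L) M t"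
    and der: "derives L G \<S> s"
  shows "model_sequent (formulas L) M s"
proof -
  let ?F = "formulas L"
  from der have "\<forall>a\<in>worlds M. locally_true ?F M a s"
  proof (induction rule: derives.induct)
    case (assumption s)
    then show ?case using S model_sequent_iff_locally_true[OF frame] by blast
  next
    case (identity \<phi>)
    then show ?case by (simp add: locally_true_iff)
  next
    case (weaken_left \<Gamma> E \<Delta>)
    then show ?case by (auto simp: locally_true_iff)
  next
    case (weaken_right \<Gamma> \<psi>)
    then show ?case by (auto simp: locally_true_iff)
  next
    case (cut \<Gamma> \<phi> \<Delta> E)
    then show ?case by (fastforce simp: locally_true_iff)
  next
    case (right_rule c P \<sigma> \<Gamma>)
    have "canonical_rule L (RightRule c P)"
      using sys right_rule.hyps(1) unfolding canonical_system_def by blast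
    then have pr: "\<sigma> (principal L c) \<in> ?F"
      by (intro is_subst_principal[OF right_rule.hyps(2)]) simp
    show ?case
    proof
      fix a assume a: "a \<in> worlds M"
      have "val M a (\<sigma> (principal L c))" if "\<forall>\<psi>\<in>\<Gamma>. val M a \<psi>"
      proof -
        have "fulfils ?F M \<sigma> a (RightRule c P)"
          using satisfies_of_context[OF frame right_rule.hyps(4) that] right_rule.IH by auto
        then have "locally_satisfies ?F M \<sigma> a ({}, {principal L c})"
          using legal_rule[OF leg right_rule.hyps(1) a right_rule.hyps(2)] pr by simp
        then show ?thesis
          by (simp add: locally_satisfies_def subst_sequent_def locally_true_iff)
      qed
      then show "locally_true ?F M a (\<Gamma>, {\<sigma> (principal L c)})"
        using right_rule.hyps(4) pr by (simp add: locally_true_iff)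
    qed
  next
    case (left_rule c H S \<sigma> \<Gamma> E)
    have "canonical_rule L (LeftRule c H S)"
      using sys left_rule.hyps(1) unfolding canonical_system_def by blast
    then have rule: "c \<in> dom L" "premises_for L c S" "\<forall>(\<Sigma>, E)\<in>S. E = {}"
      by simp_all
    have pr: "\<sigma> (principal L c) \<in> ?F" by (rule is_subst_principal[OF left_rule.hyps(2) rule(1)])
    have \<Gamma>: "\<Gamma> \<subseteq> ?F" "E \<subseteq> ?F" using left_rule.hyps(3) by (simp_all add: is_sequent_def)
    show ?case
    proof
      fix a assume a: "a \<in> worlds M"
      have "\<exists>\<phi>. E = {\<phi>} \<and> val M a \<phi>"
        if ctx: "\<forall>\<psi>\<in>\<Gamma>. val M a \<psi>" and val: "val M a (\<sigma> (principal L c))"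
      proof (rule ccontr)
        \<comment> \<open>A soft premise is derived with right-hand side \<open>E\<close> but has to
          be locally satisfied with an empty one. The failure of \<open>E\<close> at
          \<open>a\<close> bridges the two.\<close>
        assume nE: "\<not> ?thesis"
        have "satisfies ?F M \<sigma> a s" if "s \<in> H" for s
          using satisfies_of_context[OF frame \<Gamma>(1) ctx] left_rule.IH(1) that by (cases s) blast
        moreover have "locally_satisfies ?F M \<sigma> a s" if sS: "s \<in> S" for s
        proof -
          obtain \<Sigma> where s: "s = (\<Sigma>, {})" using rule(3) sS by (cases s) auto
          have "\<sigma> ` \<Sigma> \<subseteq> ?F"
            using premises_for_subst(2)[OF rule(2) _ left_rule.hyps(2)] sS s by blast
          moreover have "locally_true ?F M a (\<Gamma> \<union> \<sigma> ` \<Sigma>, E)"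
            using left_rule.IH(2) sS a s by blast
          ultimately show ?thesis
            using ctx nE s
            by (auto simp: locally_satisfies_def subst_sequent_def locally_true_iff)
        qed
        ultimately have "fulfils ?F M \<sigma> a (LeftRule c H S)" by simp
        then have "locally_satisfies ?F M \<sigma> a ({principal L c}, {})"
          using legal_rule[OF leg left_rule.hyps(1) a left_rule.hyps(2)] pr by simp
        then show False
          using val by (simp add: locally_satisfies_def subst_sequent_def locally_true_iff)
      qed
      then show "locally_true ?F M a (\<Gamma> \<union> {\<sigma> (principal L c)}, E)"
        using \<Gamma> pr by (auto simp: locally_true_iff)
    qed
  qed
  then show ?thesis using model_sequent_iff_locally_true[OF frame] by blast
qed

section \<open>Derivability from possibly infinite sets of formulas\<close>

definition proves ::
    "'c lang \<Rightarrow> 'c rule set \<Rightarrow> 'c sequent set \<Rightarrow> 'c fm set \<Rightarrow> 'c fm set \<Rightarrow> bool" where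
  "proves L G \<S> T E \<longleftrightarrow> (\<exists>\<Gamma>. finite \<Gamma> \<and> \<Gamma> \<subseteq> T \<and> derives L G \<S> (\<Gamma>, E))"

lemma provesI: "derives L G \<S> (\<Gamma>, E) \<Longrightarrow> finite \<Gamma> \<Longrightarrow> \<Gamma> \<subseteq> T \<Longrightarrow> proves L G \<S> T E"
  unfolding proves_def by blast

lemma proves_mono: "proves L G \<S> T E \<Longrightarrow> T \<subseteq> T' \<Longrightarrow> proves L G \<S> T' E"
  unfolding proves_def by blast

lemma derives_weaken:
  "derives L G \<S> (\<Gamma>, E) \<Longrightarrow> \<Gamma> \<subseteq> \<Gamma>' \<Longrightarrow> finite \<Gamma>' \<Longrightarrow> \<Gamma>' \<subseteq> formulas L \<Longrightarrow>
    derives L G \<S> (\<Gamma>', E)"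
  using derives.weaken_left[of L G \<S> \<Gamma> E \<Gamma>'] by (simp add: Un_absorb1)

lemma proves_weaken_right:
  assumes "proves L G \<S> T {}" "E \<subseteq> formulas L" "at_most_one E"
  shows "proves L G \<S> T E"
  using assms by (elim at_most_one_cases) (auto simp: proves_def intro: derives.weaken_right)

text \<open>The derivation may use only some of \<Delta>. Removing these from its left side and
  weakening by all of \<Delta> yields the shape that cut and the canonical rules expect.\<close>

lemma proves_union_finite:
  assumes "proves L G \<S> (T \<union> \<Delta>) E" "finite \<Delta>" "T \<subseteq> formulas L" "\<Delta> \<subseteq> formulas L"
  obtains \<Gamma> where "finite \<Gamma>" "\<Gamma> \<subseteq> T" "derives L G \<S> (\<Gamma> \<union> \<Delta>, E)"
proof -
  obtain \<Gamma> where \<Gamma>: "finite \<Gamma>" "\<Gamma> \<subseteq> T \<union> \<Delta>" "derives L G \<S> (\<Gamma>, E)"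
    using assms(1) unfolding proves_def by blast
  have "derives L G \<S> ((\<Gamma> - \<Delta>) \<union> \<Delta>, E)"
    by (rule derives_weaken[OF \<Gamma>(3)]) (use \<Gamma> assms in auto)
  with \<Gamma> show thesis using that[of "\<Gamma> - \<Delta>"] by blast
qed

lemma proves_cut:
  assumes "proves L G \<S> T {\<phi>}" "proves L G \<S> (insert \<phi> T) E" "T \<subseteq> formulas L" "\<phi> \<in> formulas L"
  shows "proves L G \<S> T E"
proof -
  obtain \<Gamma> where \<Gamma>: "finite \<Gamma>" "\<Gamma> \<subseteq> T" "derives L G \<S> (\<Gamma>, {\<phi>})"
    using assms(1) unfolding proves_def by blast
  obtain \<Delta> where \<Delta>: "finite \<Delta>" "\<Delta> \<subseteq> T" "derives L G \<S> (\<Delta> \<union> {\<phi>}, E)"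
    using proves_union_finite[of L G \<S> T "{\<phi>}" E] assms by auto
  show ?thesis
    by (rule provesI[OF derives.cut[OF \<Gamma>(3) \<Delta>(3)]]) (use \<Gamma> \<Delta> in auto)
qed

text \<open>A canonical rule needs one context for all its premises. There are finitely many
  premises, so the union of their finite contexts serves. The freedom to enlarge it to any finite
  \<Gamma>' within \<open>T\<close> later lets hard and soft premises share a context.\<close>

lemma common_context:
  assumes "finite P" "T \<subseteq> formulas L"
    and "\<And>s. s \<in> P \<Longrightarrow> finite (f s) \<and> f s \<subseteq> formulas L \<and> proves L G \<S> (T \<union> f s) (g s)"
  obtains \<Gamma> where "finite \<Gamma>" "\<Gamma> \<subseteq> T"
    "\<forall>s\<in>P. \<forall>\<Gamma>'. finite \<Gamma>' \<and> \<Gamma> \<subseteq> \<Gamma>' \<and> \<Gamma>' \<subseteq> T \<longrightarrow>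
      derives L G \<S> (\<Gamma>' \<union> f s, g s)"
proof -
  have "\<forall>s\<in>P. \<exists>\<Gamma>. finite \<Gamma> \<and> \<Gamma> \<subseteq> T \<and> derives L G \<S> (\<Gamma> \<union> f s, g s)"
    using proves_union_finite assms(2,3) by metis
  then obtain h where h: "\<forall>s\<in>P. finite (h s) \<and> h s \<subseteq> T \<and> derives L G \<S> (h s \<union> f s, g s)"
    by metis
  show thesis
  proof (rule that[of "\<Union>(h ` P)"])
    show "finite (\<Union>(h ` P))" "\<Union>(h ` P) \<subseteq> T" using h assms(1) by auto
  next
    show "\<forall>s\<in>P. \<forall>\<Gamma>'. finite \<Gamma>' \<and> \<Union>(h ` P) \<subseteq> \<Gamma>' \<and> \<Gamma>' \<subseteq> T \<longrightarrow>
      derives L G \<S> (\<Gamma>' \<union> f s, g s)"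
    proof (intro ballI allI impI)
      fix s \<Gamma>'
      assume s: "s \<in> P" and "finite \<Gamma>' \<and> \<Union>(h ` P) \<subseteq> \<Gamma>' \<and> \<Gamma>' \<subseteq> T"
      then have \<Gamma>': "\<Union>(h ` P) \<subseteq> \<Gamma>'" "\<Gamma>' \<subseteq> T" "finite \<Gamma>'" by blast+
      show "derives L G \<S> (\<Gamma>' \<union> f s, g s)"
      proof (rule derives_weaken)
        show "derives L G \<S> (h s \<union> f s, g s)" using h s by blast
      qed (use s \<Gamma>' assms in auto)
    qed
  qed
qed

section \<open>Maximal sets that do not derive a given right-hand side\<close>

definition maximal_for ::
    "'c lang \<Rightarrow> 'c rule set \<Rightarrow> 'c sequent set \<Rightarrow> 'c fm set \<Rightarrow> 'c fm set \<Rightarrow> bool" where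
  "maximal_for L G \<S> E T \<longleftrightarrow> T \<subseteq> formulas L \<and> \<not> proves L G \<S> T E \<and>
    (\<forall>\<phi>\<in>formulas L - T. proves L G \<S> (insert \<phi> T) E)"

text \<open>Zorn's lemma applies because a derivation uses finitely many formulas of the union of a
  chain, and these lie in a single member.\<close>

lemma maximal_extension:
  assumes "T \<subseteq> formulas L" "\<not> proves L G \<S> T E"
  obtains T' where "T \<subseteq> T'" "maximal_for L G \<S> E T'"
proof -
  define A where "A = {T'. T \<subseteq> T' \<and> T' \<subseteq> formulas L \<and> \<not> proves L G \<S> T' E}"
  have "\<exists>M\<in>A. \<forall>X\<in>A. M \<subseteq> X \<longrightarrow> X = M"
  proof (rule subset_Zorn_nonempty)
    show "A \<noteq> {}" using assms unfolding A_def by blast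
  next
    fix C assume C: "C \<noteq> {}" "subset.chain A C"
    have "\<not> proves L G \<S> (\<Union>C) E"
    proof
      assume "proves L G \<S> (\<Union>C) E"
      then obtain \<Gamma> where \<Gamma>: "finite \<Gamma>" "\<Gamma> \<subseteq> \<Union>C" "derives L G \<S> (\<Gamma>, E)"
        unfolding proves_def by blast
      then obtain X where X: "X \<in> C" "\<Gamma> \<subseteq> X"
        using finite_subset_Union_chain[OF \<Gamma>(1,2) C] by metis
      then have "proves L G \<S> X E" using \<Gamma> provesI by blast
      moreover have "X \<in> A" using X C(2) unfolding subset_chain_def by blast
      ultimately show False unfolding A_def by blast
    qed
    moreover have "C \<subseteq> A" using C(2) unfolding subset_chain_def by blast
    ultimately show "\<Union>C \<in> A" using C(1) unfolding A_def by blast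
  qed
  then obtain M where M: "M \<in> A" "\<forall>X\<in>A. M \<subseteq> X \<longrightarrow> X = M" by blast
  have "proves L G \<S> (insert \<phi> M) E" if "\<phi> \<in> formulas L - M" for \<phi>
  proof (rule ccontr)
    assume "\<not> ?thesis"
    then have "insert \<phi> M \<in> A" using M(1) that unfolding A_def by blast
    then show False using M(2) that by blast
  qed
  then show thesis using that M(1) unfolding A_def maximal_for_def by blast
qed

text \<open>If \<phi> were missing, adding it to \<open>T\<close> would derive \<open>E\<close>, and
  a cut on \<phi> would derive \<open>E\<close> from \<open>T\<close> alone.\<close>

lemma maximal_for_closed:
  assumes "maximal_for L G \<S> E T" "proves L G \<S> T {\<phi>}" "\<phi> \<in> formulas L"
  shows "\<phi> \<in> T"
  using assms proves_cut[of L G \<S> T \<phi> E] unfolding maximal_for_def by blast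

lemma maximal_for_separates:
  assumes "maximal_for L G \<S> E T" "E \<subseteq> formulas L" "at_most_one E"
  shows "E \<inter> T = {}"
proof (rule ccontr)
  assume "\<not> ?thesis"
  then obtain \<phi> where "E = {\<phi>}" "\<phi> \<in> T" using assms(3) by (auto elim: at_most_one_cases)
  then have "proves L G \<S> T E"
    using assms by (intro provesI[of L G \<S> "{\<phi>}"]) (auto intro: derives.identity)
  then show False using assms unfolding maximal_for_def by blast
qed

section \<open>The canonical frame\<close>

text \<open>The set \<open>\<B>\<close> of formulas that hold in every world serves the consequence relation between
  formulas, with \<open>\<S>\<close> empty; for the one between sequents \<open>\<B>\<close> is empty.\<close>

definition canonical_frame ::
    "'c lang \<Rightarrow> 'c rule set \<Rightarrow> 'c sequent set \<Rightarrow> 'c fm set \<Rightarrow> ('c, 'c fm set) semiframe" where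
  "canonical_frame L G \<S> \<B> =
    (let W = {T. \<B> \<subseteq> T \<and> (\<exists>E \<subseteq> formulas L. at_most_one E \<and> maximal_for L G \<S> E T)}
     in \<lparr>worlds = W, le = {(T, T'). T \<in> W \<and> T' \<in> W \<and> T \<subseteq> T'}, val = (\<lambda>T \<phi>. \<phi> \<in> T)\<rparr>)"

lemma canonical_frame_simps:
  "T \<in> worlds (canonical_frame L G \<S> \<B>) \<longleftrightarrow>
    \<B> \<subseteq> T \<and> (\<exists>E \<subseteq> formulas L. at_most_one E \<and> maximal_for L G \<S> E T)"
  "(T, T') \<in> le (canonical_frame L G \<S> \<B>) \<longleftrightarrow>
    T \<in> worlds (canonical_frame L G \<S> \<B>) \<and> T' \<in> worlds (canonical_frame L G \<S> \<B>) \<and> T \<subseteq> T'"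
  "val (canonical_frame L G \<S> \<B>) T \<phi> \<longleftrightarrow> \<phi> \<in> T"
  unfolding canonical_frame_def Let_def by simp_all

text \<open>This is the source of refuting worlds: a set maximal for \<open>E\<close> itself
  contains no member of \<open>E\<close>, by the identity axiom.\<close>

lemma canonical_world_extension:
  assumes "T \<subseteq> formulas L" "\<B> \<subseteq> T" "\<not> proves L G \<S> T E" "E \<subseteq> formulas L" "at_most_one E"
  obtains T' where "T' \<in> worlds (canonical_frame L G \<S> \<B>)" "T \<subseteq> T'" "E \<inter> T' = {}"
  using assms maximal_extension[of T L G \<S> E] maximal_for_separates[of L G \<S> E]
  unfolding canonical_frame_simps by (metis subset_trans)

lemma canonical_world_formulas:
  "T \<in> worlds (canonical_frame L G \<S> \<B>) \<Longrightarrow> T \<subseteq> formulas L"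
  by (auto simp: canonical_frame_simps maximal_for_def)

text \<open>For empty \<open>E\<close> the claim is that no world derives the empty right-hand side:
  weakening on the right would derive the set that the world is maximal for. For a singleton it is
  closure under derivability.\<close>

lemma canonical_world_closed:
  assumes "T \<in> worlds (canonical_frame L G \<S> \<B>)" "proves L G \<S> T E" "E \<subseteq> formulas L"
    "at_most_one E"
  shows "\<exists>\<phi>. E = {\<phi>} \<and> \<phi> \<in> T"
proof -
  obtain E' where E': "E' \<subseteq> formulas L" "at_most_one E'" "maximal_for L G \<S> E' T"
    using assms(1) by (auto simp: canonical_frame_simps)
  from assms(4) show ?thesis
  proof (cases rule: at_most_one_cases)
    case 1
    then show ?thesis
      using proves_weaken_right[of L G \<S> T E'] assms(2) E' unfolding maximal_for_def by blast
  next
    case (2 \<phi>)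
    then show ?thesis using maximal_for_closed[OF E'(3)] assms by blast
  qed
qed

text \<open>Nonemptiness has to be assumed: if \<B> derives the empty right-hand side, no superset
  of \<B> is maximal for anything.\<close>

lemma is_frame_canonical:
  assumes "worlds (canonical_frame L G \<S> \<B>) \<noteq> {}"
  shows "is_frame L (canonical_frame L G \<S> \<B>)"
proof -
  have "set \<psi>s \<subseteq> formulas L" if "Conn c \<psi>s \<in> formulas L" for c and \<psi>s :: "'a fm list"
    using that by (cases rule: formulas.cases) auto
  then show ?thesis
    using assms unfolding is_semiframe_def subformula_closed_def partial_order_on_def
      preorder_on_def refl_on_def trans_def antisym_def
    by (auto simp: canonical_frame_simps(2,3))
qed

lemma canonical_frame_model:
  assumes "t \<in> \<S>" "is_sequent L t" "worlds (canonical_frame L G \<S> \<B>) \<noteq> {}"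
  shows "model_sequent (formulas L) (canonical_frame L G \<S> \<B>) t"
  unfolding model_sequent_iff_locally_true[OF is_frame_canonical[OF assms(3)]]
proof
  fix T assume T: "T \<in> worlds (canonical_frame L G \<S> \<B>)"
  obtain \<Gamma> E where t: "t = (\<Gamma>, E)" by (cases t)
  have "proves L G \<S> T E" if "\<Gamma> \<subseteq> T"
    using assms(1,2) t that by (intro provesI[of L G \<S> \<Gamma>])
      (auto simp: is_sequent_def intro: derives.assumption)
  then show "locally_true (formulas L) (canonical_frame L G \<S> \<B>) T t"
    using canonical_world_closed[OF T, of E] assms(2) t
    by (auto simp: locally_true_iff is_sequent_def canonical_frame_simps(3))
qed

section \<open>Legality of the canonical frame\<close>

text \<open>Truth at \<open>T\<close> speaks of all larger worlds. Were the premise not derivable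
  over \<open>T\<close>, some larger world would contain its left side and omit its right
  side.\<close>

lemma proves_of_satisfies:
  assumes T: "T \<in> worlds (canonical_frame L G \<S> \<B>)"
    and P: "premises_for L c P" "(\<Pi>, E) \<in> P" "is_subst L \<sigma>"
    and sat: "satisfies (formulas L) (canonical_frame L G \<S> \<B>) \<sigma> T (\<Pi>, E)"
  shows "proves L G \<S> (T \<union> \<sigma> ` \<Pi>) (\<sigma> ` E)"
proof (rule ccontr)
  assume n: "\<not> ?thesis"
  note pf = premises_for_subst[OF P]
  \<comment> \<open>Keeping \<B> inside the set ensures that its maximal extension is a world of the
    same frame.\<close>
  have "T \<union> \<sigma> ` \<Pi> \<subseteq> formulas L" "\<B> \<subseteq> T \<union> \<sigma> ` \<Pi>"
    using pf(2) T canonical_world_formulas[OF T] by (auto simp: canonical_frame_simps(1))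
  then obtain T' where T': "T' \<in> worlds (canonical_frame L G \<S> \<B>)" "T \<union> \<sigma> ` \<Pi> \<subseteq> T'"
    "\<sigma> ` E \<inter> T' = {}"
    by (rule canonical_world_extension[OF _ _ n pf(3,4)])
  then have "locally_true (formulas L) (canonical_frame L G \<S> \<B>) T' (\<sigma> ` \<Pi>, \<sigma> ` E)"
    using sat T by (auto simp: satisfies_def true_at_def subst_sequent_def canonical_frame_simps(2))
  then have "(\<forall>\<psi>\<in>\<sigma> ` \<Pi>. \<psi> \<in> T') \<longrightarrow> (\<exists>\<phi>. \<sigma> ` E = {\<phi>} \<and> \<phi> \<in> T')"
    unfolding locally_true_iff canonical_frame_simps(3) by (rule conjunct2)
  moreover have "\<forall>\<psi>\<in>\<sigma> ` \<Pi>. \<psi> \<in> T'" using T'(2) by blast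
  ultimately obtain \<phi> where "\<sigma> ` E = {\<phi>}" "\<phi> \<in> T'" by blast
  with T'(3) show False by simp
qed

lemma common_context_of_satisfies:
  assumes T: "T \<in> worlds (canonical_frame L G \<S> \<B>)"
    and P: "premises_for L c P" "is_subst L \<sigma>"
    and sat: "\<forall>s\<in>P. satisfies (formulas L) (canonical_frame L G \<S> \<B>) \<sigma> T s"
  obtains \<Gamma> where "finite \<Gamma>" "\<Gamma> \<subseteq> T"
    "\<forall>(\<Pi>, E)\<in>P. \<forall>\<Gamma>'. finite \<Gamma>' \<and> \<Gamma> \<subseteq> \<Gamma>' \<and> \<Gamma>' \<subseteq> T \<longrightarrow>
      derives L G \<S> (\<Gamma>' \<union> \<sigma> ` \<Pi>, \<sigma> ` E)"
proof -
  have fin: "finite P" using P unfolding premises_for_def by blast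
  have *: "finite (\<sigma> ` fst s) \<and> \<sigma> ` fst s \<subseteq> formulas L \<and>
      proves L G \<S> (T \<union> \<sigma> ` fst s) (\<sigma> ` snd s)"
    if s: "s \<in> P" for s
  proof -
    have s': "(fst s, snd s) \<in> P" using s by simp
    have "satisfies (formulas L) (canonical_frame L G \<S> \<B>) \<sigma> T (fst s, snd s)"
      using sat s by simp
    then show ?thesis
      using premises_for_subst(1,2)[OF P(1) s' P(2)] proves_of_satisfies[OF T P(1) s' P(2)] by blast
  qed
  obtain \<Gamma> where \<Gamma>: "finite \<Gamma>" "\<Gamma> \<subseteq> T"
    "\<forall>s\<in>P. \<forall>\<Gamma>'. finite \<Gamma>' \<and> \<Gamma> \<subseteq> \<Gamma>' \<and> \<Gamma>' \<subseteq> T \<longrightarrow>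
      derives L G \<S> (\<Gamma>' \<union> \<sigma> ` fst s, \<sigma> ` snd s)"
    by (rule common_context[OF fin canonical_world_formulas[OF T] *])
  show thesis
    by (rule that[OF \<Gamma>(1,2)]) (use \<Gamma>(3) in auto)
qed

text \<open>The satisfied premises are derivable over one finite part of \<open>T\<close>, so the
  right rule applies there and closure of worlds under derivability finishes.\<close>

lemma canonical_frame_right:
  assumes G: "RightRule c P \<in> G" "canonical_rule L (RightRule c P)"
    and T: "T \<in> worlds (canonical_frame L G \<S> \<B>)" and \<sigma>: "is_subst L \<sigma>"
    and ful: "fulfils (formulas L) (canonical_frame L G \<S> \<B>) \<sigma> T (RightRule c P)"
  shows "\<sigma> (principal L c) \<in> T"
proof -
  have P: "c \<in> dom L" "premises_for L c P" using G(2) by auto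
  have sat: "\<forall>s\<in>P. satisfies (formulas L) (canonical_frame L G \<S> \<B>) \<sigma> T s"
    using ful by simp
  obtain \<Gamma> where \<Gamma>: "finite \<Gamma>" "\<Gamma> \<subseteq> T" and
    der: "\<forall>(\<Pi>, E)\<in>P. \<forall>\<Gamma>'. finite \<Gamma>' \<and> \<Gamma> \<subseteq> \<Gamma>' \<and> \<Gamma>' \<subseteq> T \<longrightarrow>
      derives L G \<S> (\<Gamma>' \<union> \<sigma> ` \<Pi>, \<sigma> ` E)"
    by (rule common_context_of_satisfies[OF T P(2) \<sigma> sat])
  have "derives L G \<S> (\<Gamma>, {\<sigma> (principal L c)})"
    by (rule derives.right_rule[OF G(1) \<sigma>]) (use der \<Gamma> canonical_world_formulas[OF T] in auto)
  then have "proves L G \<S> T {\<sigma> (principal L c)}" using provesI \<Gamma> by blast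
  then show ?thesis
    using canonical_world_closed[OF T] is_subst_principal[OF \<sigma> P(1)]
    by (auto simp: at_most_one_def)
qed

text \<open>If the principal formula were in \<open>T\<close>, the left rule would derive from
  \<open>T\<close> the very set that \<open>T\<close> is maximal for.\<close>

lemma canonical_frame_left:
  assumes G: "LeftRule c H S \<in> G" "canonical_rule L (LeftRule c H S)"
    and T: "T \<in> worlds (canonical_frame L G \<S> \<B>)" and \<sigma>: "is_subst L \<sigma>"
    and ful: "fulfils (formulas L) (canonical_frame L G \<S> \<B>) \<sigma> T (LeftRule c H S)"
  shows "\<sigma> (principal L c) \<notin> T"
proof
  assume pr: "\<sigma> (principal L c) \<in> T"
  have P: "premises_for L c H" "premises_for L c S" "\<forall>(\<Sigma>, F)\<in>S. F = {}" using G(2) by auto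
  note TF = canonical_world_formulas[OF T]
  \<comment> \<open>This \<open>E\<close> becomes the right-hand side of the application of the left
    rule.\<close>
  obtain E where E: "E \<subseteq> formulas L" "at_most_one E" "maximal_for L G \<S> E T"
    using T by (auto simp: canonical_frame_simps)
  have sat: "\<forall>s\<in>H. satisfies (formulas L) (canonical_frame L G \<S> \<B>) \<sigma> T s"
    using ful by simp
  obtain \<Gamma> where \<Gamma>: "finite \<Gamma>" "\<Gamma> \<subseteq> T" and
    hard: "\<forall>(\<Pi>, F)\<in>H. \<forall>\<Gamma>'. finite \<Gamma>' \<and> \<Gamma> \<subseteq> \<Gamma>' \<and> \<Gamma>' \<subseteq> T \<longrightarrow>
      derives L G \<S> (\<Gamma>' \<union> \<sigma> ` \<Pi>, \<sigma> ` F)"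
    by (rule common_context_of_satisfies[OF T P(1) \<sigma> sat])
  have *: "finite (\<sigma> ` fst s) \<and> \<sigma> ` fst s \<subseteq> formulas L \<and> proves L G \<S> (T \<union> \<sigma> ` fst s) E"
    if s: "s \<in> S" for s
  proof -
    obtain \<Sigma> where \<Sigma>: "s = (\<Sigma>, {})" using P(3) s by (cases s) auto
    have pf: "finite (\<sigma> ` \<Sigma>)" "\<sigma> ` \<Sigma> \<subseteq> formulas L"
      using premises_for_subst(1,2)[OF P(2) _ \<sigma>] s \<Sigma> by blast+
    have "locally_satisfies (formulas L) (canonical_frame L G \<S> \<B>) \<sigma> T (\<Sigma>, {})"
      using ful s \<Sigma> by auto
    \<comment> \<open>With an empty right side, local truth can only come from a formula of the left
      side that is missing from \<open>T\<close>.\<close>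
    then obtain \<phi> where \<phi>: "\<phi> \<in> \<sigma> ` \<Sigma>" "\<phi> \<notin> T"
      by (auto simp: locally_satisfies_def subst_sequent_def locally_true_iff
          canonical_frame_simps(3))
    then have "proves L G \<S> (insert \<phi> T) E" using E(3) pf unfolding maximal_for_def by blast
    then have "proves L G \<S> (T \<union> \<sigma> ` \<Sigma>) E" by (rule proves_mono) (use \<phi> in auto)
    then show ?thesis using pf \<Sigma> by simp
  qed
  have fin: "finite S" using P(2) unfolding premises_for_def by blast
  obtain \<Delta> where \<Delta>: "finite \<Delta>" "\<Delta> \<subseteq> T" and
    soft: "\<forall>s\<in>S. \<forall>\<Gamma>'. finite \<Gamma>' \<and> \<Delta> \<subseteq> \<Gamma>' \<and> \<Gamma>' \<subseteq> T \<longrightarrow>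
      derives L G \<S> (\<Gamma>' \<union> \<sigma> ` fst s, E)"
    by (rule common_context[OF fin TF *])
  \<comment> \<open>The union of both contexts is admissible for hard and soft premises alike, as
    each set of premises allows enlarged contexts.\<close>
  have "derives L G \<S> ((\<Gamma> \<union> \<Delta>) \<union> {\<sigma> (principal L c)}, E)"
  proof (rule derives.left_rule[OF G(1) \<sigma>])
    show "is_sequent L (\<Gamma> \<union> \<Delta>, E)" using \<Gamma> \<Delta> TF E by (auto simp: is_sequent_def)
  next
    fix \<Pi> F assume "(\<Pi>, F) \<in> H"
    then show "derives L G \<S> ((\<Gamma> \<union> \<Delta>) \<union> \<sigma> ` \<Pi>, \<sigma> ` F)" using hard \<Gamma> \<Delta> by fastforce
  next
    fix \<Sigma> F assume "(\<Sigma>, F) \<in> S"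
    then show "derives L G \<S> ((\<Gamma> \<union> \<Delta>) \<union> \<sigma> ` \<Sigma>, E)"
      using soft \<Gamma> \<Delta> by fastforce
  qed
  then have "proves L G \<S> T E" by (rule provesI) (use \<Gamma> \<Delta> pr in auto)
  then show False using E(3) unfolding maximal_for_def by blast
qed

lemma legal_canonical_frame:
  assumes "canonical_system L G"
  shows "legal L (formulas L) G (canonical_frame L G \<S> \<B>)"
  unfolding legal_def respects_rule_def
proof (intro ballI allI impI, elim conjE)
  let ?M = "canonical_frame L G \<S> \<B>"
  fix r T \<sigma>
  assume r: "r \<in> G" and T: "T \<in> worlds ?M" and \<sigma>: "is_subst L \<sigma>"
    and ful: "fulfils (formulas L) ?M \<sigma> T r"
    and pr: "\<sigma> (principal L (rule_conn r)) \<in> formulas L"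
  have can: "canonical_rule L r" using assms r unfolding canonical_system_def by blast
  show "locally_satisfies (formulas L) ?M \<sigma> T (conclusion L r)"
  proof (cases r)
    case (RightRule c P)
    with canonical_frame_right[of c P, OF _ _ T \<sigma>] r can ful pr show ?thesis
      by (simp add: locally_satisfies_def subst_sequent_def locally_true_iff
          canonical_frame_simps(3))
  next
    case (LeftRule c H S)
    with canonical_frame_left[of c H S, OF _ _ T \<sigma>] r can ful pr show ?thesis
      by (simp add: locally_satisfies_def subst_sequent_def locally_true_iff
          canonical_frame_simps(3))
  qed
qed

section \<open>Completeness for both consequence relations\<close>

text \<open>Validity is assumed only over frames whose worlds are sets of formulas, the type of the
  canonical frame. \<B> collects formulas assumed true at all worlds, while \<Gamma> is the left
  side to be refuted at one world.\<close>

lemma completeness: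
  fixes L :: "'c lang"
  assumes sys: "canonical_system L G" and S: "\<forall>t\<in>\<S>. is_sequent L t"
    and T: "\<B> \<subseteq> formulas L" "\<Gamma> \<subseteq> formulas L" and E: "E \<subseteq> formulas L" "at_most_one E"
    and val: "\<And>M :: ('c, 'c fm set) semiframe. is_frame L M \<Longrightarrow> legal L (formulas L) G M \<Longrightarrow>
      \<forall>t\<in>\<S>. model_sequent (formulas L) M t \<Longrightarrow> \<forall>\<phi>\<in>\<B>. model_fm M \<phi> \<Longrightarrow>
      model_sequent (formulas L) M (\<Gamma>, E)"
  shows "proves L G \<S> (\<B> \<union> \<Gamma>) E"
proof (rule ccontr)
  let ?M = "canonical_frame L G \<S> \<B>"
  assume n: "\<not> ?thesis"
  \<comment> \<open>At this world \<Gamma> holds and \<open>E\<close> fails. It also shows that the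
    frame is nonempty.\<close>
  obtain T' where T': "T' \<in> worlds ?M" "\<B> \<union> \<Gamma> \<subseteq> T'" "E \<inter> T' = {}"
    using canonical_world_extension[OF _ _ n E, of \<B>] T by blast
  then have ne: "worlds ?M \<noteq> {}" by blast
  have "model_sequent (formulas L) ?M (\<Gamma>, E)"
  proof (rule val)
    show "\<forall>t\<in>\<S>. model_sequent (formulas L) ?M t" using canonical_frame_model[OF _ _ ne] S by blast
    show "\<forall>\<phi>\<in>\<B>. model_fm ?M \<phi>" by (auto simp: model_fm_def canonical_frame_simps)
  qed (use is_frame_canonical[OF ne] legal_canonical_frame[OF sys] in auto)
  then have "locally_true (formulas L) ?M T' (\<Gamma>, E)"
    using T'(1) model_sequent_iff_locally_true[OF is_frame_canonical[OF ne]] by blast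
  then show False using T' by (auto simp: locally_true_iff canonical_frame_simps(3))
qed

section \<open>Equivalence of derivability and entailment\<close>

lemma derives_imp_entails_sequent:
  "canonical_system L G \<Longrightarrow> derives L G \<S> s \<Longrightarrow> entails_sequent TYPE('w) L G \<S> s"
  unfolding entails_sequent_def using soundness by blast

lemma entails_sequent_imp_derives:
  fixes L :: "'c lang"
  assumes "canonical_system L G" "\<forall>t\<in>\<S>. is_sequent L t" "is_sequent L s"
    "entails_sequent TYPE('c fm set) L G \<S> s"
  shows "derives L G \<S> s"
proof -
  obtain \<Gamma> E where s: "s = (\<Gamma>, E)" by (cases s)
  then have seq: "finite \<Gamma>" "\<Gamma> \<subseteq> formulas L" "E \<subseteq> formulas L" "at_most_one E"
    using assms(3) by (auto simp: is_sequent_def)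
  have "proves L G \<S> ({} \<union> \<Gamma>) E"
    using completeness[OF assms(1,2) _ seq(2-4), of "{}"] assms(4)
    unfolding entails_sequent_def s by blast
  then show ?thesis
    using derives_weaken seq(1,2) unfolding proves_def s by auto
qed

lemma derives_imp_entails_fm:
  fixes L :: "'c lang"
  assumes "canonical_system L G" "derives_fm L G \<T> E"
  shows "entails_fm TYPE('w) L G \<T> E"
  unfolding entails_fm_def
proof (intro allI impI, elim conjE)
  fix M :: "('c, 'w) semiframe"
  assume M: "is_frame L M" "legal L (formulas L) G M" "\<forall>\<phi>\<in>\<T>. model_fm M \<phi>"
  obtain \<Gamma> where "\<Gamma> \<subseteq> \<T>" "derives L G {} (\<Gamma>, E)"
    using assms(2) unfolding derives_fm_def by blast
  then have "locally_true (formulas L) M a (\<Gamma>, E)" "\<forall>\<phi>\<in>\<Gamma>. val M a \<phi>" if "a \<in> worlds M" for a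
    using soundness[OF assms(1) M(1,2), of "{}" "(\<Gamma>, E)"] M(3) that
    unfolding model_sequent_iff_locally_true[OF M(1)] model_fm_def by blast+
  then show "model_sequent (formulas L) M ({}, E)"
    unfolding model_sequent_iff_locally_true[OF M(1)] locally_true_iff by blast
qed

lemma entails_fm_imp_derives:
  fixes L :: "'c lang"
  assumes "canonical_system L G" "\<T> \<subseteq> formulas L" "E \<subseteq> formulas L" "at_most_one E"
    "entails_fm TYPE('c fm set) L G \<T> E"
  shows "derives_fm L G \<T> E"
proof -
  \<comment> \<open>The possibly infinite theory enters as \<B>; both the extra axioms and the left
    side to be refuted are empty.\<close>
  have "proves L G {} (\<T> \<union> {}) E"
    using completeness[OF assms(1) _ assms(2) _ assms(3,4), of "{}" "{}"] assms(5)
    unfolding entails_fm_def by blast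
  then show ?thesis by (simp add: proves_def derives_fm_def)
qed

text \<open>Entailment over the single type \<open>'c fm set\<close> already yields derivability,
  and derivability yields entailment over any type \<open>'w\<close> of worlds. Together these give
  the equivalence for frames of every type.\<close>

theorem theorem6p5:
  fixes L :: "'c lang" and G :: "'c rule set"
  assumes "canonical_system L G" and "coherent G"
  shows "(\<forall>\<S> s. (\<forall>t\<in>\<S>. is_sequent L t) \<and> is_sequent L s \<longrightarrow>
            (derives L G \<S> s \<longleftrightarrow> entails_sequent TYPE('c fm set) L G \<S> s) \<and>
            (derives L G \<S> s \<longrightarrow> entails_sequent TYPE('w) L G \<S> s))
       \<and> (\<forall>\<T> E. \<T> \<subseteq> formulas L \<and> E \<subseteq> formulas L \<and> at_most_one E \<longrightarrow>
            (derives_fm L G \<T> E \<longleftrightarrow> entails_fm TYPE('c fm set) L G \<T> E) \<and>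
            (derives_fm L G \<T> E \<longrightarrow> entails_fm TYPE('w) L G \<T> E))"
  using assms(1) derives_imp_entails_sequent entails_sequent_imp_derives
    derives_imp_entails_fm entails_fm_imp_derives by metis

end
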